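(* Let $\mathsf K$ be a class of FL${}_{\mathrm e}$-algebras in which $1$ is the greatest and $0$ the least element, and let ${\Rightarrow}\in\{\Rightarrow_{\circ},\Rightarrow_{\wedge}\}$. Then ${\Rightarrow}$ is weakly connexive for $\mathsf K$ if and only if ${\Rightarrow}$ is proto-connexive for $\mathsf K$. Moreover, for any subvariety $\mathsf V$ of $\mathsf{FL}_{\mathsf{ew}}$, the class $Q_w(\mathsf V)$ is a variety, namely the subvariety of $\mathsf V$ axiomatized by $1\leq\neg(x{\Rightarrow}\neg x)$.
   Context: An FL${}_{\mathrm e}$-algebra is an algebra $\langle A,\wedge,\vee,\cdot,\to,0,1\rangle$ such that $\langle A,\wedge,\vee\rangle$ is a lattice (with order $\leq$), $\langle A,\cdot,1\rangle$ is a commutative monoid, $0$ is an arbitrary constant, and $x\cdot y\leq z\iff x\leq y\to z$. $\mathsf{FL}_{\mathsf{ew}}$ is the variety of FL${}_{\mathrm e}$-algebras with $1$ greatest and $0$ least. Write $\neg x:=x\to 0$, $x\Rightarrow_{\wedge} y:=(x\to y)\wedge(y\to\neg\neg x)$, $x\Rightarrow_{\circ} y:=(x\to y)\cdot(y\to\neg\neg x)$. ${\Rightarrow}$ is proto-connexive for a class $\mathsf K$ if every member satisfies, for all $x,y$: (AT) $1\leq\neg(x{\Rightarrow}\neg x)$, (AT') $1\leq\neg(\neg x{\Rightarrow} x)$, (BT) $1\leq (x{\Rightarrow} y){\Rightarrow}\neg(x{\Rightarrow}\neg y)$, (BT') $1\leq (x{\Rightarrow}\neg y){\Rightarrow}\neg(x{\Rightarrow}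 y)$. ${\Rightarrow}$ is weakly connexive for $\mathsf K$ if every member satisfies (AT), (AT') and the quasi-identities (BTw) $1\leq x{\Rightarrow} y$ implies $1\leq\neg(x{\Rightarrow}\neg y)$, and (BTw') $1\leq x{\Rightarrow}\neg y$ implies $1\leq\neg(x{\Rightarrow} y)$. For a variety $\mathsf V$, $Q_w(\mathsf V)$ is the quasivariety of members of $\mathsf V$ satisfying (AT), (AT'), (BTw), (BTw') for ${\Rightarrow}$. *)

theory Defs
  imports "HOL-Algebra.Group"
begin

text \<open>The monoid \<open>(A, \<cdot>, 1)\<close> is the \<^typ>\<open>'a monoid\<close> part; \<open>falsum\<close> is the constant \<open>0\<close>.\<close>

record 'a fl_alg = "'a monoid" +
  meet :: "'a \<Rightarrow> 'a \<Rightarrow> 'a"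
  join :: "'a \<Rightarrow> 'a \<Rightarrow> 'a"
  resid :: "'a \<Rightarrow> 'a \<Rightarrow> 'a"
  falsum :: "'a"

definition is_algebra :: "'a fl_alg \<Rightarrow> bool" where
  "is_algebra A \<longleftrightarrow>
     one A \<in> carrier A \<and> falsum A \<in> carrier A \<and>
     (\<forall>x\<in>carrier A. \<forall>y\<in>carrier A.
        mult A x y \<in> carrier A \<and> meet A x y \<in> carrier A \<and>
        join A x y \<in> carrier A \<and> resid A x y \<in> carrier A)"

definition is_lattice :: "'a fl_alg \<Rightarrow> bool" where
  "is_lattice A \<longleftrightarrow>
     (\<forall>x\<in>carrier A. \<forall>y\<in>carrier A.
        meet A x y = meet A y x \<and> join A x y = join A y x \<and>
        meet A x (join A x y) = x \<and> join A x (meet A x y) = x \<and>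
        (\<forall>z\<in>carrier A.
           meet A (meet A x y) z = meet A x (meet A y z) \<and>
           join A (join A x y) z = join A x (join A y z)))"

definition le :: "'a fl_alg \<Rightarrow> 'a \<Rightarrow> 'a \<Rightarrow> bool" where
  "le A x y \<longleftrightarrow> meet A x y = x"

definition FLe :: "'a fl_alg set" where
  "FLe = {A. is_algebra A \<and> is_lattice A \<and> comm_monoid A \<and>
     (\<forall>x\<in>carrier A. \<forall>y\<in>carrier A. \<forall>z\<in>carrier A.
        le A (mult A x y) z \<longleftrightarrow> le A x (resid A y z))}"

definition FLew :: "'a fl_alg set" where
  "FLew = {A \<in> FLe. \<forall>x\<in>carrier A. le A x (one A) \<and> le A (falsum A) x}"

datatype trm =
    Var nat
  | Meet trm trm
  | Join trm trm
  | Mult trm trm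
  | Res trm trm
  | Zero
  | One

type_synonym identity = "trm \<times> trm"

primrec eval :: "'a fl_alg \<Rightarrow> (nat \<Rightarrow> 'a) \<Rightarrow> trm \<Rightarrow> 'a" where
  "eval A v (Var n) = v n"
| "eval A v (Meet s t) = meet A (eval A v s) (eval A v t)"
| "eval A v (Join s t) = join A (eval A v s) (eval A v t)"
| "eval A v (Mult s t) = mult A (eval A v s) (eval A v t)"
| "eval A v (Res s t) = resid A (eval A v s) (eval A v t)"
| "eval A v Zero = falsum A"
| "eval A v One = one A"

definition holds :: "'a fl_alg \<Rightarrow> (nat \<Rightarrow> 'a) \<Rightarrow> identity \<Rightarrow> bool" where
  "holds A v e \<longleftrightarrow> eval A v (fst e) = eval A v (snd e)"

definition satisfies :: "'a fl_alg \<Rightarrow> identity \<Rightarrow> bool" where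
  "satisfies A e \<longleftrightarrow> (\<forall>v. (\<forall>n. v n \<in> carrier A) \<longrightarrow> holds A v e)"

definition satisfies_quasi :: "'a fl_alg \<Rightarrow> identity \<Rightarrow> identity \<Rightarrow> bool" where
  "satisfies_quasi A p c \<longleftrightarrow>
     (\<forall>v. (\<forall>n. v n \<in> carrier A) \<longrightarrow> holds A v p \<longrightarrow> holds A v c)"

definition Mod :: "identity set \<Rightarrow> 'a fl_alg set" where
  "Mod E = {A. is_algebra A \<and> (\<forall>e\<in>E. satisfies A e)}"

text \<open>Varieties are taken as equational classes, among all algebras of the signature
  with carrier in \<^typ>\<open>'a\<close>; closure under products cannot be expressed inside one type.\<close>

definition is_variety :: "'a fl_alg set \<Rightarrow> bool" where
  "is_variety V \<longleftrightarrow> (\<exists>E. V = Mod E)"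

text \<open>An inequality \<open>s \<le> t\<close> is the identity \<open>s \<and> t = s\<close>; its satisfaction is
  thus \<^const>\<open>le\<close> between the values of \<open>s\<close> and \<open>t\<close>.\<close>

definition Leq :: "trm \<Rightarrow> trm \<Rightarrow> identity" where
  "Leq s t = (Meet s t, s)"

definition Neg :: "trm \<Rightarrow> trm" where
  "Neg s = Res s Zero"

definition arrow_meet :: "trm \<Rightarrow> trm \<Rightarrow> trm" where
  "arrow_meet s t = Meet (Res s t) (Res t (Neg (Neg s)))"

definition arrow_mult :: "trm \<Rightarrow> trm \<Rightarrow> trm" where
  "arrow_mult s t = Mult (Res s t) (Res t (Neg (Neg s)))"

abbreviation (input) X :: trm where "X \<equiv> Var 0"
abbreviation (input) Y :: trm where "Y \<equiv> Var 1"

context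
  fixes arr :: "trm \<Rightarrow> trm \<Rightarrow> trm"
begin

definition AT :: identity where
  "AT = Leq One (Neg (arr X (Neg X)))"

definition AT' :: identity where
  "AT' = Leq One (Neg (arr (Neg X) X))"

definition BT :: identity where
  "BT = Leq One (arr (arr X Y) (Neg (arr X (Neg Y))))"

definition BT' :: identity where
  "BT' = Leq One (arr (arr X (Neg Y)) (Neg (arr X Y)))"

definition BTw :: "'a fl_alg \<Rightarrow> bool" where
  "BTw A \<longleftrightarrow> satisfies_quasi A (Leq One (arr X Y)) (Leq One (Neg (arr X (Neg Y))))"

definition BTw' :: "'a fl_alg \<Rightarrow> bool" where
  "BTw' A \<longleftrightarrow> satisfies_quasi A (Leq One (arr X (Neg Y))) (Leq One (Neg (arr X Y)))"

definition proto_connexive :: "'a fl_alg set \<Rightarrow> bool" where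
  "proto_connexive K \<longleftrightarrow>
     (\<forall>A\<in>K. satisfies A AT \<and> satisfies A AT' \<and> satisfies A BT \<and> satisfies A BT')"

definition weakly_connexive :: "'a fl_alg set \<Rightarrow> bool" where
  "weakly_connexive K \<longleftrightarrow>
     (\<forall>A\<in>K. satisfies A AT \<and> satisfies A AT' \<and> BTw A \<and> BTw' A)"

definition Q_w :: "'a fl_alg set \<Rightarrow> 'a fl_alg set" where
  "Q_w V = {A \<in> V. satisfies A AT \<and> satisfies A AT' \<and> BTw A \<and> BTw' A}"

end

end

theory Submission imports Defs begin

text \<open>Both arrows have the form \<open>x \<Rightarrow> y = (x \<rightarrow> y) \<circ> (y \<rightarrow> \<not>\<not>x)\<close> for an operation \<open>\<circ>\<close> lying
  between \<open>\<cdot>\<close> and \<open>\<and>\<close>. Since \<open>x \<le> \<not>((\<not>x)\<^sup>2)\<close>, (AT) gives \<open>\<not>(x\<^sup>2) \<cdot> x = 0\<close>; hence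
  \<open>\<not>(x\<^sup>2) = \<not>x\<close> and no nonzero element is nilpotent. With \<open>p = x \<Rightarrow> y\<close> and
  \<open>q = x \<Rightarrow> \<not>y\<close>, the product \<open>pq\<close> lies below both \<open>\<not>(x\<^sup>2)\<close> and
  \<open>\<not>((\<not>x)\<^sup>2)\<close>, so \<open>(pq)\<^sup>2 = 0\<close> and \<open>pq = 0\<close>. Moreover
  \<open>r = \<not>p \<cdot> \<not>q\<close> annihilates \<open>xy \<le> p\<close> and \<open>\<not>x\<not>y \<le> p\<close>, so \<open>r\<^sup>2 \<le> \<not>(xy) \<cdot> \<not>(\<not>x\<not>y) \<le> q\<close>
  and \<open>r\<^sup>3 = 0\<close>, that is \<open>r = 0\<close>. The two (BT) laws and their weak forms follow from
  \<open>pq = 0\<close> and \<open>\<not>p \<cdot> \<not>q = 0\<close>.\<close>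

section \<open>Order and residuation in a single FL_ew-algebra\<close>

locale flew = comm_monoid A for A :: "'a fl_alg" (structure) +
  assumes in_FLew: "A \<in> FLew"
begin

abbreviation le_A (infix "\<preceq>" 50) where "x \<preceq> y \<equiv> le A x y"
abbreviation resid_A (infixr "\<leadsto>" 60) where "x \<leadsto> y \<equiv> resid A x y"
abbreviation bot_A ("\<zero>") where "\<zero> \<equiv> falsum A"
abbreviation neg_A ("\<sim> _" [80] 80) where "\<sim> x \<equiv> resid A x (falsum A)"

lemma zero_closed [simp, intro]: "\<zero> \<in> carrier A"
  and meet_closed [simp, intro]: "x \<in> carrier A \<Longrightarrow> y \<in> carrier A \<Longrightarrow> meet A x y \<in> carrier A"
  and resid_closed [simp, intro]: "x \<in> carrier A \<Longrightarrow> y \<in> carrier A \<Longrightarrow> x \<leadsto> y \<in> carrier A"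
  using in_FLew by (auto simp: FLew_def FLe_def is_algebra_def)

lemma lattice_A: "is_lattice A"
  using in_FLew by (auto simp: FLew_def FLe_def)

lemma meet_comm: "x \<in> carrier A \<Longrightarrow> y \<in> carrier A \<Longrightarrow> meet A x y = meet A y x"
  and meet_assoc: "x \<in> carrier A \<Longrightarrow> y \<in> carrier A \<Longrightarrow> z \<in> carrier A \<Longrightarrow>
    meet A (meet A x y) z = meet A x (meet A y z)"
  using lattice_A unfolding is_lattice_def by blast+

lemma meet_idem: "x \<in> carrier A \<Longrightarrow> meet A x x = x"
  using lattice_A unfolding is_lattice_def by (metis meet_closed)

lemma le_refl [simp, intro]: "x \<in> carrier A \<Longrightarrow> x \<preceq> x"
  by (simp add: le_def meet_idem)

lemma le_trans:
  "x \<preceq> y \<Longrightarrow> y \<preceq> z \<Longrightarrow> x \<in> carrier A \<Longrightarrow> y \<in> carrier A \<Longrightarrow> z \<in> carrier A \<Longrightarrow> x \<preceq> z"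
  unfolding le_def by (metis meet_assoc)

lemma meet_le1: "x \<in> carrier A \<Longrightarrow> y \<in> carrier A \<Longrightarrow> meet A x y \<preceq> x"
  unfolding le_def by (metis meet_assoc meet_comm meet_idem)

lemma meet_le2: "x \<in> carrier A \<Longrightarrow> y \<in> carrier A \<Longrightarrow> meet A x y \<preceq> y"
  unfolding le_def by (metis meet_assoc meet_idem)

lemma le_meet: "z \<preceq> x \<Longrightarrow> z \<preceq> y \<Longrightarrow> x \<in> carrier A \<Longrightarrow> y \<in> carrier A \<Longrightarrow> z \<in> carrier A \<Longrightarrow>
  z \<preceq> meet A x y"
  unfolding le_def by (metis meet_assoc)

lemma le_one [simp, intro]: "x \<in> carrier A \<Longrightarrow> x \<preceq> \<one>"
  using in_FLew by (auto simp: FLew_def)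

lemma residuation:
  "x \<in> carrier A \<Longrightarrow> y \<in> carrier A \<Longrightarrow> z \<in> carrier A \<Longrightarrow> x \<otimes> y \<preceq> z \<longleftrightarrow> x \<preceq> y \<leadsto> z"
  using in_FLew by (auto simp: FLew_def FLe_def)

lemma one_le_resid: "x \<in> carrier A \<Longrightarrow> y \<in> carrier A \<Longrightarrow> \<one> \<preceq> x \<leadsto> y \<longleftrightarrow> x \<preceq> y"
  using residuation[of \<one> x y] by simp

text \<open>In the left argument this is residuation: from a'b \<le> a'b one gets a \<le> a' \<le> b
  \<rightarrow> a'b. Commutativity transfers it to the right argument.\<close>

lemma mult_mono:
  assumes "x \<preceq> x'" "y \<preceq> y'"
    and [simp]: "x \<in> carrier A" "x' \<in> carrier A" "y \<in> carrier A" "y' \<in> carrier A"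
  shows "x \<otimes> y \<preceq> x' \<otimes> y'"
proof -
  have right: "a \<otimes> b \<preceq> a' \<otimes> b"
    if "a \<preceq> a'" and [simp]: "a \<in> carrier A" "a' \<in> carrier A" "b \<in> carrier A" for a a' b
  proof -
    have "a' \<preceq> b \<leadsto> (a' \<otimes> b)" by (simp flip: residuation)
    then have "a \<preceq> b \<leadsto> (a' \<otimes> b)" using that by (blast intro: le_trans)
    then show ?thesis by (simp add: residuation)
  qed
  have "x \<otimes> y \<preceq> x' \<otimes> y" using assms by (simp add: right)
  moreover have "x' \<otimes> y \<preceq> x' \<otimes> y'" using right[of y y' x'] assms by (simp add: m_comm)
  ultimately show ?thesis by (rule le_trans) simp_all
qed

lemma mult_le1: "x \<in> carrier A \<Longrightarrow> y \<in> carrier A \<Longrightarrow> x \<otimes> y \<preceq> x"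
  using mult_mono[of x x y \<one>] by simp

lemma mult_le2: "x \<in> carrier A \<Longrightarrow> y \<in> carrier A \<Longrightarrow> x \<otimes> y \<preceq> y"
  using mult_mono[of x \<one> y y] by simp

lemma mult_le_meet: "x \<in> carrier A \<Longrightarrow> y \<in> carrier A \<Longrightarrow> x \<otimes> y \<preceq> meet A x y"
  by (simp add: le_meet mult_le1 mult_le2)

lemma modus_ponens: "x \<in> carrier A \<Longrightarrow> y \<in> carrier A \<Longrightarrow> (x \<leadsto> y) \<otimes> x \<preceq> y"
  by (simp add: residuation)

lemma le_resid: "x \<in> carrier A \<Longrightarrow> y \<in> carrier A \<Longrightarrow> y \<preceq> x \<leadsto> y"
  by (simp add: mult_le1 flip: residuation)

lemma neg_le_resid:
  assumes [simp]: "x \<in> carrier A" "y \<in> carrier A"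
  shows "\<sim> x \<preceq> x \<leadsto> y"
proof -
  have "\<zero> \<preceq> y" using in_FLew by (auto simp: FLew_def)
  from le_trans[OF modus_ponens this] have "\<sim> x \<otimes> x \<preceq> y" by simp
  then show ?thesis by (simp add: residuation)
qed

lemma le_neg_neg: "x \<in> carrier A \<Longrightarrow> x \<preceq> \<sim> \<sim> x"
  using modus_ponens[of x \<zero>] by (simp add: m_comm flip: residuation)

lemma resid_neg_le:
  assumes [simp]: "x \<in> carrier A" "y \<in> carrier A"
  shows "\<sim> (x \<otimes> y) \<preceq> x \<leadsto> \<sim> y"
  using modus_ponens[of "x \<otimes> y" \<zero>] by (simp add: m_assoc flip: residuation)

lemma trans_resid:
  assumes [simp]: "x \<in> carrier A" "y \<in> carrier A" "z \<in> carrier A"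
  shows "(x \<leadsto> y) \<otimes> (y \<leadsto> z) \<preceq> x \<leadsto> z"
proof -
  have "(y \<leadsto> z) \<otimes> ((x \<leadsto> y) \<otimes> x) \<preceq> (y \<leadsto> z) \<otimes> y"
    by (simp add: mult_mono modus_ponens)
  then have "(y \<leadsto> z) \<otimes> ((x \<leadsto> y) \<otimes> x) \<preceq> z"
    by (rule le_trans[OF _ modus_ponens]) simp_all
  then have "((x \<leadsto> y) \<otimes> (y \<leadsto> z)) \<otimes> x \<preceq> z" by (simp add: m_ac)
  then show ?thesis by (simp add: residuation)
qed

text \<open>By residuation both sides are the largest element whose product with xy is 0.\<close>

lemma contrapos_neg:
  assumes [simp]: "x \<in> carrier A" "y \<in> carrier A"
  shows "x \<leadsto> \<sim> y \<preceq> y \<leadsto> \<sim> x"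
proof -
  have "(x \<leadsto> \<sim> y) \<preceq> x \<leadsto> \<sim> y" by simp
  then have "((x \<leadsto> \<sim> y) \<otimes> x) \<otimes> y \<preceq> \<zero>" by (simp add: residuation)
  then have "((x \<leadsto> \<sim> y) \<otimes> y) \<otimes> x \<preceq> \<zero>" by (simp add: m_ac)
  then show ?thesis by (simp add: residuation)
qed

end

section \<open>Arrows built from an operation between product and meet\<close>

locale flew_arrow = flew +
  fixes conj :: "'a \<Rightarrow> 'a \<Rightarrow> 'a"  (infixl "\<odot>" 65)
  assumes conj_closed [simp, intro]: "x \<in> carrier A \<Longrightarrow> y \<in> carrier A \<Longrightarrow> x \<odot> y \<in> carrier A"
    and mult_le_conj: "x \<in> carrier A \<Longrightarrow> y \<in> carrier A \<Longrightarrow> x \<otimes> y \<preceq> x \<odot> y"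
    and conj_le1: "x \<in> carrier A \<Longrightarrow> y \<in> carrier A \<Longrightarrow> x \<odot> y \<preceq> x"
    and conj_le2: "x \<in> carrier A \<Longrightarrow> y \<in> carrier A \<Longrightarrow> x \<odot> y \<preceq> y"
begin

definition arrow (infixr "\<Rrightarrow>" 60) where
  "x \<Rrightarrow> y = (x \<leadsto> y) \<odot> (y \<leadsto> \<sim> \<sim> x)"

lemma arrow_closed [simp, intro]: "x \<in> carrier A \<Longrightarrow> y \<in> carrier A \<Longrightarrow> x \<Rrightarrow> y \<in> carrier A"
  by (simp add: arrow_def)

lemma one_le_conj:
  assumes "\<one> \<preceq> x" "\<one> \<preceq> y" and [simp]: "x \<in> carrier A" "y \<in> carrier A"
  shows "\<one> \<preceq> x \<odot> y"
proof -
  have "\<one> \<preceq> x \<otimes> y" using mult_mono[of \<one> x \<one> y] assms by simp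
  then show ?thesis by (rule le_trans[OF _ mult_le_conj]) simp_all
qed

text \<open>Source of all lower bounds for arrows: bounding the two components separately and
  multiplying works for either choice of \<open>conj\<close>, because \<open>conj\<close> dominates
  the product.\<close>

lemma mult_le_arrow:
  assumes "u \<preceq> x \<leadsto> y" "w \<preceq> y \<leadsto> \<sim> \<sim> x"
    and [simp]: "x \<in> carrier A" "y \<in> carrier A" "u \<in> carrier A" "w \<in> carrier A"
  shows "u \<otimes> w \<preceq> x \<Rrightarrow> y"
proof -
  have "u \<otimes> w \<preceq> (x \<leadsto> y) \<otimes> (y \<leadsto> \<sim> \<sim> x)" using assms by (simp add: mult_mono)
  then show ?thesis
    unfolding arrow_def by (rule le_trans[OF _ mult_le_conj]) simp_all
qed

lemma prod_le_arrow:
  assumes [simp]: "x \<in> carrier A" "y \<in> carrier A"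
  shows "x \<otimes> y \<preceq> x \<Rrightarrow> y"
proof -
  have "x \<preceq> y \<leadsto> \<sim> \<sim> x" by (rule le_trans[OF le_neg_neg le_resid]) simp_all
  then have "y \<otimes> x \<preceq> x \<Rrightarrow> y" by (intro mult_le_arrow le_resid) simp_all
  then show ?thesis by (simp add: m_comm)
qed

text \<open>Ex falso for each component: \<not>x \<le> x \<rightarrow> y and \<not>y \<le> y
  \<rightarrow> \<not>\<not>x, since 0 is least.\<close>

lemma neg_prod_le_arrow:
  assumes [simp]: "x \<in> carrier A" "y \<in> carrier A"
  shows "\<sim> x \<otimes> \<sim> y \<preceq> x \<Rrightarrow> y"
  by (intro mult_le_arrow neg_le_resid) simp_all

end

section \<open>Consequences of Aristotle's thesis\<close>

locale flew_aristotle = flew_arrow +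
  assumes aristotle: "x \<in> carrier A \<Longrightarrow> x \<Rrightarrow> \<sim> x \<preceq> \<zero>"
begin

text \<open>The factors are the two components of x \<Rightarrow> \<not>x; by residuation they equal
  the negated squares of x and of \<not>x. The later lemmas use (AT) only through this
  inequality.\<close>

lemma mult_neg_squares:
  assumes [simp]: "x \<in> carrier A"
  shows "(x \<leadsto> \<sim> x) \<otimes> (\<sim> x \<leadsto> \<sim> \<sim> x) \<preceq> \<zero>"
  by (rule le_trans[OF mult_le_arrow aristotle[of x]]) simp_all

text \<open>If x \<le> \<not>x, the first factor in \<open>mult_neg_squares\<close> is 1, while x
  always lies below the second.\<close>

lemma le_neg_self:
  assumes [simp]: "x \<in> carrier A" and "x \<preceq> \<sim> x"
  shows "x \<preceq> \<zero>"
proof -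
  have "x \<preceq> \<sim> x \<leadsto> \<sim> \<sim> x" by (rule le_trans[OF le_neg_neg le_resid]) simp_all
  moreover have "\<one> \<preceq> x \<leadsto> \<sim> x" using assms(2) by (simp add: one_le_resid)
  ultimately have "\<one> \<otimes> x \<preceq> (x \<leadsto> \<sim> x) \<otimes> (\<sim> x \<leadsto> \<sim> \<sim> x)" by (intro mult_mono) simp_all
  then have "\<one> \<otimes> x \<preceq> \<zero>" by (rule le_trans[OF _ mult_neg_squares]) simp_all
  then show ?thesis by simp
qed

lemma square_le_zero: "x \<otimes> x \<preceq> \<zero> \<Longrightarrow> x \<in> carrier A \<Longrightarrow> x \<preceq> \<zero>"
  by (simp add: le_neg_self residuation)

text \<open>The fourth power lies below the cube, so \<open>square_le_zero\<close> applies
  twice.\<close>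

lemma cube_le_zero:
  assumes cube: "x \<otimes> (x \<otimes> x) \<preceq> \<zero>" and [simp]: "x \<in> carrier A"
  shows "x \<preceq> \<zero>"
proof -
  have "(x \<otimes> (x \<otimes> x)) \<otimes> x \<preceq> x \<otimes> (x \<otimes> x)" by (simp add: mult_le1)
  then have "(x \<otimes> (x \<otimes> x)) \<otimes> x \<preceq> \<zero>" by (rule le_trans[OF _ cube]) simp_all
  then have "(x \<otimes> x) \<otimes> (x \<otimes> x) \<preceq> \<zero>" by (simp add: m_assoc)
  then have "x \<otimes> x \<preceq> \<zero>" by (rule square_le_zero) simp
  then show ?thesis by (rule square_le_zero) simp
qed

lemma aristotle':
  assumes [simp]: "x \<in> carrier A"
  shows "\<sim> x \<Rrightarrow> x \<preceq> \<zero>"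
proof -
  let ?p = "\<sim> x \<Rrightarrow> x"
  have "?p \<preceq> \<sim> x \<leadsto> x" by (simp add: arrow_def conj_le1)
  then have "?p \<otimes> \<sim> x \<preceq> x" by (simp add: residuation)
  then have "?p \<otimes> \<sim> x \<preceq> \<sim> \<sim> x" by (rule le_trans[OF _ le_neg_neg]) simp_all
  then have B: "?p \<preceq> \<sim> x \<leadsto> \<sim> \<sim> x" by (simp add: residuation)
  \<comment> \<open>The second component of \<open>?p\<close> carries a triple negation.
    Contraposition moves a double negation to the premise, where x \<le> \<not>\<not>x removes
    it.\<close>
  have "?p \<preceq> x \<leadsto> \<sim> \<sim> \<sim> x" by (simp add: arrow_def conj_le2)
  then have "?p \<preceq> \<sim> \<sim> x \<leadsto> \<sim> x" by (rule le_trans[OF _ contrapos_neg]) simp_all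
  moreover have "\<sim> \<sim> x \<leadsto> \<sim> x \<preceq> x \<leadsto> \<sim> x"
  proof -
    have "(\<sim> \<sim> x \<leadsto> \<sim> x) \<otimes> x \<preceq> (\<sim> \<sim> x \<leadsto> \<sim> x) \<otimes> \<sim> \<sim> x"
      by (simp add: mult_mono le_neg_neg)
    then have "(\<sim> \<sim> x \<leadsto> \<sim> x) \<otimes> x \<preceq> \<sim> x" by (rule le_trans[OF _ modus_ponens]) simp_all
    then show ?thesis by (simp add: residuation)
  qed
  ultimately have "?p \<preceq> x \<leadsto> \<sim> x" by (rule le_trans) simp_all
  then have "?p \<otimes> ?p \<preceq> (x \<leadsto> \<sim> x) \<otimes> (\<sim> x \<leadsto> \<sim> \<sim> x)" using B by (intro mult_mono) simp_all
  then have "?p \<otimes> ?p \<preceq> \<zero>" by (rule le_trans[OF _ mult_neg_squares]) simp_all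
  then show ?thesis by (rule square_le_zero) simp
qed

lemma arrow_mult_arrow_neg:
  assumes [simp]: "x \<in> carrier A" "y \<in> carrier A"
  shows "(x \<Rrightarrow> y) \<otimes> (x \<Rrightarrow> \<sim> y) \<preceq> \<zero>"
proof -
  let ?p = "x \<Rrightarrow> y" and ?q = "x \<Rrightarrow> \<sim> y"
  have p1: "?p \<preceq> x \<leadsto> y" and p2: "?p \<preceq> y \<leadsto> \<sim> \<sim> x"
    and q1: "?q \<preceq> x \<leadsto> \<sim> y" and q2: "?q \<preceq> \<sim> y \<leadsto> \<sim> \<sim> x"
    by (simp_all add: arrow_def conj_le1 conj_le2)
  \<comment> \<open>Contraposing q makes implications composable through y: x to y to \<not>x.
    Contraposing p below gives the companion chain \<not>x to \<not>y to \<not>\<not>x.\<close>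
  have "?q \<preceq> y \<leadsto> \<sim> x" using q1 by (rule le_trans[OF _ contrapos_neg]) simp_all
  then have "?p \<otimes> ?q \<preceq> (x \<leadsto> y) \<otimes> (y \<leadsto> \<sim> x)" using p1 by (intro mult_mono) simp_all
  then have l: "?p \<otimes> ?q \<preceq> x \<leadsto> \<sim> x" by (rule le_trans[OF _ trans_resid]) simp_all
  have "?p \<preceq> \<sim> x \<leadsto> \<sim> y" using p2 by (rule le_trans[OF _ contrapos_neg]) simp_all
  then have "?p \<otimes> ?q \<preceq> (\<sim> x \<leadsto> \<sim> y) \<otimes> (\<sim> y \<leadsto> \<sim> \<sim> x)"
    using q2 by (intro mult_mono) simp_all
  then have "?p \<otimes> ?q \<preceq> \<sim> x \<leadsto> \<sim> \<sim> x" by (rule le_trans[OF _ trans_resid]) simp_all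
  with l have "(?p \<otimes> ?q) \<otimes> (?p \<otimes> ?q) \<preceq> (x \<leadsto> \<sim> x) \<otimes> (\<sim> x \<leadsto> \<sim> \<sim> x)"
    by (intro mult_mono) simp_all
  then have "(?p \<otimes> ?q) \<otimes> (?p \<otimes> ?q) \<preceq> \<zero>" by (rule le_trans[OF _ mult_neg_squares]) simp_all
  then show ?thesis by (rule square_le_zero) simp_all
qed

lemma neg_arrow_mult_neg_arrow_neg:
  assumes [simp]: "x \<in> carrier A" "y \<in> carrier A"
  shows "\<sim> (x \<Rrightarrow> y) \<otimes> \<sim> (x \<Rrightarrow> \<sim> y) \<preceq> \<zero>"
proof -
  let ?p = "x \<Rrightarrow> y" and ?q = "x \<Rrightarrow> \<sim> y"
  let ?r = "\<sim> ?p \<otimes> \<sim> ?q"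
  \<comment> \<open>Since r annihilates both arrows, it annihilates everything below either of
    them.\<close>
  have r: "?r \<preceq> \<sim> u" if "u \<preceq> w" "w = ?p \<or> w = ?q" and [simp]: "u \<in> carrier A" for u w
  proof -
    have [simp]: "w \<in> carrier A" using that(2) by auto
    have "?r \<preceq> \<sim> w" using that(2) by (auto simp: mult_le1 mult_le2)
    then have "?r \<otimes> u \<preceq> \<sim> w \<otimes> w" using that(1) by (intro mult_mono) simp_all
    then have "?r \<otimes> u \<preceq> \<zero>" by (rule le_trans[OF _ modus_ponens]) simp_all
    then show ?thesis by (simp add: residuation)
  qed
  have "?r \<preceq> \<sim> (x \<otimes> y)" by (rule r[OF prod_le_arrow]) simp_all
  then have A: "?r \<preceq> x \<leadsto> \<sim> y" by (rule le_trans[OF _ resid_neg_le]) simp_all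
  have "?r \<preceq> \<sim> (\<sim> x \<otimes> \<sim> y)" by (rule r[OF neg_prod_le_arrow]) simp_all
  \<comment> \<open>The factors are swapped so that residuation leaves \<not>y as the premise, as in
    the second component of q.\<close>
  then have "?r \<preceq> \<sim> (\<sim> y \<otimes> \<sim> x)" by (simp add: m_comm)
  then have "?r \<preceq> \<sim> y \<leadsto> \<sim> \<sim> x" by (rule le_trans[OF _ resid_neg_le]) simp_all
  with A have "?r \<otimes> ?r \<preceq> ?q" by (intro mult_le_arrow) simp_all
  \<comment> \<open>The square of r lies below q, so r annihilates its own square.\<close>
  then have "?r \<preceq> \<sim> (?r \<otimes> ?r)" by (rule r) simp_all
  then have "?r \<otimes> (?r \<otimes> ?r) \<preceq> \<zero>" by (simp add: residuation)
  then show ?thesis by (rule cube_le_zero) simp_all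
qed

text \<open>The first hypothesis says p \<le> \<not>q and the second \<not>q \<le> \<not>\<not>p,
  which makes both components of the arrow equal to 1. The hypotheses are symmetric in p and q, so
  the lemma serves (BT) and (BT').\<close>

lemma one_le_arrow_neg:
  assumes "p \<otimes> q \<preceq> \<zero>" "\<sim> p \<otimes> \<sim> q \<preceq> \<zero>" and [simp]: "p \<in> carrier A" "q \<in> carrier A"
  shows "\<one> \<preceq> p \<Rrightarrow> \<sim> q"
proof -
  have "p \<preceq> \<sim> q" using assms by (simp flip: residuation)
  moreover have "\<sim> q \<preceq> \<sim> \<sim> p" using assms by (simp add: m_comm flip: residuation)
  ultimately show ?thesis
    unfolding arrow_def by (intro one_le_conj) (simp_all add: one_le_resid)
qed

lemma boethius:
  assumes [simp]: "x \<in> carrier A" "y \<in> carrier A"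
  shows "\<one> \<preceq> (x \<Rrightarrow> y) \<Rrightarrow> \<sim> (x \<Rrightarrow> \<sim> y)"
  using arrow_mult_arrow_neg[of x y] neg_arrow_mult_neg_arrow_neg[of x y]
  by (simp add: one_le_arrow_neg)

lemma boethius':
  assumes [simp]: "x \<in> carrier A" "y \<in> carrier A"
  shows "\<one> \<preceq> (x \<Rrightarrow> \<sim> y) \<Rrightarrow> \<sim> (x \<Rrightarrow> y)"
  using arrow_mult_arrow_neg[of x y] neg_arrow_mult_neg_arrow_neg[of x y]
  by (simp add: one_le_arrow_neg m_comm)

text \<open>For the weak laws: p and q are the two arrows, in either order, and the premise of the
  quasi-identity is 1 \<le> p.\<close>

lemma one_le_mult_le_zero:
  assumes "\<one> \<preceq> p" "p \<otimes> q \<preceq> \<zero>" and [simp]: "p \<in> carrier A" "q \<in> carrier A"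
  shows "\<one> \<preceq> \<sim> q"
  using le_trans[of \<one> p "\<sim> q"] assms by (simp flip: residuation)

end

section \<open>From terms and identities to the algebraic statements, and the theorem\<close>

lemma holds_Leq [simp]: "holds A v (Leq s t) \<longleftrightarrow> le A (eval A v s) (eval A v t)"
  by (simp add: holds_def Leq_def le_def)

lemma eval_Neg [simp]: "eval A v (Neg s) = resid A (eval A v s) (falsum A)"
  by (simp add: Neg_def)

lemma flew_arrow_interp:
  assumes "A \<in> FLew" "arr \<in> {arrow_mult, arrow_meet}"
  obtains conj where "flew_arrow A conj"
    and "\<And>v s t. eval A v (arr s t) = flew_arrow.arrow A conj (eval A v s) (eval A v t)"
proof -
  interpret comm_monoid A using assms(1) by (simp add: FLew_def FLe_def)
  interpret flew A using assms(1) by unfold_locales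
  have mult: "flew_arrow A (mult A)"
    by unfold_locales (simp_all add: mult_le1 mult_le2)
  have meet: "flew_arrow A (meet A)"
    by unfold_locales (simp_all add: mult_le_meet meet_le1 meet_le2)
  from assms(2) show thesis
    by (auto intro: that[OF mult] that[OF meet]
        simp: arrow_mult_def arrow_meet_def flew_arrow.arrow_def[OF mult] flew_arrow.arrow_def[OF meet])
qed

text \<open>Weak and proto-connexivity both include (AT), so this reduces each of them, and
  membership in \<open>Q_w\<close>, to (AT) alone, algebra by algebra.\<close>

lemma AT_imp_connexive:
  assumes A: "A \<in> FLew" and arr: "arr \<in> {arrow_mult, arrow_meet}" and AT: "satisfies A (AT arr)"
  shows "satisfies A (AT' arr)" "satisfies A (BT arr)" "satisfies A (BT' arr)"
    "BTw arr A" "BTw' arr A"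
proof -
  obtain conj where "flew_arrow A conj"
    and ev [simp]: "\<And>v s t. eval A v (arr s t) = flew_arrow.arrow A conj (eval A v s) (eval A v t)"
    using flew_arrow_interp[OF A arr] by blast
  then interpret flew_arrow A conj by simp
  interpret flew_aristotle A conj
  proof
    fix x assume x [simp]: "x \<in> carrier A"
    \<comment> \<open>A constant valuation suffices, as \<open>X\<close> is the only variable of
      (AT).\<close>
    have "holds A (\<lambda>_. x) (AT arr)" using AT by (simp add: satisfies_def)
    then show "le A (arrow x (resid A x (falsum A))) (falsum A)" by (simp add: AT_def one_le_resid)
  qed
  show "satisfies A (AT' arr)" "satisfies A (BT arr)" "satisfies A (BT' arr)"
    by (simp_all add: satisfies_def AT'_def BT_def BT'_def one_le_resid aristotle'
        boethius boethius')
  show "BTw arr A" "BTw' arr A"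
    unfolding BTw_def BTw'_def satisfies_quasi_def
    by (auto intro: one_le_mult_le_zero simp: arrow_mult_arrow_neg)
       (metis one_le_mult_le_zero arrow_mult_arrow_neg m_comm arrow_closed resid_closed zero_closed)
qed

theorem theorem4p9:
  fixes arr :: "trm \<Rightarrow> trm \<Rightarrow> trm"
  assumes "arr \<in> {arrow_mult, arrow_meet}"
  shows "(\<forall>K :: 'a fl_alg set. K \<subseteq> FLew \<longrightarrow>
            (weakly_connexive arr K \<longleftrightarrow> proto_connexive arr K)) \<and>
         (\<forall>V :: 'a fl_alg set. is_variety V \<and> V \<subseteq> FLew \<longrightarrow>
            is_variety (Q_w arr V) \<and> Q_w arr V = V \<inter> Mod {AT arr})"
proof (intro conjI allI impI)
  fix K :: "'a fl_alg set" assume "K \<subseteq> FLew"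
  then show "weakly_connexive arr K \<longleftrightarrow> proto_connexive arr K"
    using AT_imp_connexive[OF _ assms] unfolding weakly_connexive_def proto_connexive_def by blast
next
  fix V :: "'a fl_alg set" assume V: "is_variety V \<and> V \<subseteq> FLew"
  then obtain E where E: "V = Mod E" by (auto simp: is_variety_def)
  show Q: "Q_w arr V = V \<inter> Mod {AT arr}"
    using V AT_imp_connexive[OF _ assms] unfolding Q_w_def E by (fastforce simp: Mod_def)
  have "Q_w arr V = Mod (E \<union> {AT arr})"
    unfolding Q unfolding E by (auto simp: Mod_def)
  then show "is_variety (Q_w arr V)" unfolding is_variety_def by blast
qed

end
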